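(* Let $\mathcal F=(V,E,\phi)$ and $\mathcal G=(W,F,\psi)$ be two connected frameworks. All deformations of the Cartesian product $\mathcal F\times\mathcal G$ are of the form $\mathcal F'\times\mathcal G'$, where $\mathcal F'$ and $\mathcal G'$ are deformations of $\mathcal F$ and $\mathcal G$ respectively. Consequently, the deformation cone of $\mathcal F\times\mathcal G$ is the Cartesian product of the deformation cones of $\mathcal F$ and $\mathcal G$: $$\mathbb{DC}(\mathcal F\times\mathcal G)=\mathbb{DC}(\mathcal F)\times\mathbb{DC}(\mathcal G),$$ where a pair $(\lambda,\mu)\in \mathbb{DC}(\mathcal F)\times\mathbb{DC}(\mathcal G)$ is identified with the vector whose coordinate at each edge $(u,x)(v,x)$ (with $uv\in E$) is $\lambda_{uv}$ and whose coordinate at each edge $(u,x)(u,y)$ (with $xy\in F$) is $\mu_{xy}$.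
   Context: A framework in $\mathbb R^d$ is a triple $\mathcal F=(V,E,\phi)$ with $V$ a finite set (vertices), $E\subseteq\binom{V}{2}$ (edges), and $\phi:V\to\mathbb R^d$. It is connected if the graph $(V,E)$ is connected. An edge $uv$ is degenerate if $\phi_u=\phi_v$. A framework $(V,E,\psi)$ in $\mathbb R^d$ on the same graph is a deformation of $\mathcal F$ if for every $uv\in E$ there is $\lambda_{uv}\ge 0$ with $\psi_v-\psi_u=\lambda_{uv}(\phi_v-\phi_u)$. Its edge-deformation vector in $\mathbb R_{\ge 0}^E$ has coordinate $\lambda_{uv}$ for non-degenerate $uv$ and $0$ for degenerate $uv$. The deformation cone $\mathbb{DC}(\mathcal F)\subset\mathbb R^E$ is the set of edge-deformation vectors of all deformations of $\mathcal F$. The Cartesian product of $\mathcal F=(V,E,\phi)$ in $\mathbb R^d$ and $\mathcal G=(W,F,\psi)$ in $\mathbb R^e$ is the framework $\mathcal F\times\mathcal G$ in $\mathbb R^{d+e}$ with vertex set $V\times W$, edges $(u,x)(v,x)$ for $uv\in E$, $x\in W$, and $(u,x)(u,y)$ for $u\in V$, $xy\in F$, and realization $(v,x)\mapsto(\phi_v,\psi_x)$. *)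

theory Defs
  imports "HOL-Analysis.Analysis" "HOL-Library.FuncSet"
begin

record ('v, 'd :: finite) framework =
  verts :: "'v set"
  edges :: "'v set set"
  pos :: "'v \<Rightarrow> real ^ 'd"

text \<open>
  A map defined on a set \<open>V\<close> only is encoded as a total function that is extensional on \<open>V\<close>,
  so that equality of frameworks (and of vectors in \<open>\<real>\<^sup>E\<close> below) is equality in HOL.
\<close>

definition is_framework :: "('v, 'd :: finite) framework \<Rightarrow> bool" where
  "is_framework F \<longleftrightarrow>
     finite (verts F) \<and>
     edges F \<subseteq> {e. e \<subseteq> verts F \<and> card e = 2} \<and>
     pos F \<in> extensional (verts F)"

text \<open>As usual, a connected graph has at least one vertex.\<close>

definition connected_framework :: "('v, 'd :: finite) framework \<Rightarrow> bool" where
  "connected_framework F \<longleftrightarrow>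
     verts F \<noteq> {} \<and>
     (\<forall>u\<in>verts F. \<forall>v\<in>verts F. (u, v) \<in> {(a, b). {a, b} \<in> edges F}\<^sup>*)"

definition degenerate :: "('v, 'd :: finite) framework \<Rightarrow> 'v set \<Rightarrow> bool" where
  "degenerate F e \<longleftrightarrow> (\<exists>u v. e = {u, v} \<and> pos F u = pos F v)"

definition is_deformation ::
  "('v, 'd :: finite) framework \<Rightarrow> ('v, 'd) framework \<Rightarrow> bool" where
  "is_deformation F F' \<longleftrightarrow>
     is_framework F' \<and> verts F' = verts F \<and> edges F' = edges F \<and>
     (\<forall>u v. {u, v} \<in> edges F \<longrightarrow>
        (\<exists>l\<ge>0. pos F' v - pos F' u = l *\<^sub>R (pos F v - pos F u)))"

text \<open>
  On a non-degenerate edge the coefficient is unique and does not depend on the orientation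
  of the edge, so the definite description below is well defined.
\<close>

definition edge_deformation_vector ::
  "('v, 'd :: finite) framework \<Rightarrow> ('v, 'd) framework \<Rightarrow> 'v set \<Rightarrow> real" where
  "edge_deformation_vector F F' =
     (\<lambda>e\<in>edges F.
        if degenerate F e then 0
        else (THE l. l \<ge> 0 \<and>
               (\<forall>u v. e = {u, v} \<longrightarrow> pos F' v - pos F' u = l *\<^sub>R (pos F v - pos F u))))"

definition deformation_cone :: "('v, 'd :: finite) framework \<Rightarrow> ('v set \<Rightarrow> real) set" where
  "deformation_cone F = {edge_deformation_vector F F' | F'. is_deformation F F'}"

text \<open>Concatenation of vectors; \<open>\<real>\<^sup>d\<^sup>+\<^sup>e\<close> is indexed by the sum type.\<close>

definition vec_append :: "real ^ 'd \<Rightarrow> real ^ 'e \<Rightarrow> real ^ ('d :: finite + 'e :: finite)" where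
  "vec_append a b = (\<chi> i. case i of Inl j \<Rightarrow> a $ j | Inr k \<Rightarrow> b $ k)"

definition framework_prod ::
  "('v, 'd :: finite) framework \<Rightarrow> ('w, 'e :: finite) framework \<Rightarrow> ('v \<times> 'w, 'd + 'e) framework"
  (infixr "\<times>\<^sub>F" 80) where
  "F \<times>\<^sub>F G =
     \<lparr> verts = verts F \<times> verts G,
       edges = {{(u, x), (v, x)} | u v x. {u, v} \<in> edges F \<and> x \<in> verts G} \<union>
               {{(u, x), (u, y)} | u x y. u \<in> verts F \<and> {x, y} \<in> edges G},
       pos = (\<lambda>(v, x)\<in>verts F \<times> verts G. vec_append (pos F v) (pos G x)) \<rparr>"

text \<open>
  The identification of a pair of edge vectors with an edge vector of the product. The first
  projection maps an edge \<open>{(u, x), (v, x)}\<close> to the edge \<open>{u, v}\<close>, and an edge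
  \<open>{(u, x), (u, y)}\<close> to the singleton \<open>{u}\<close>, which is never an edge; see the two lemmas below.
\<close>

definition edge_vector_pair ::
  "('v, 'd :: finite) framework \<Rightarrow> ('w, 'e :: finite) framework \<Rightarrow>
   ('v set \<Rightarrow> real) \<times> ('w set \<Rightarrow> real) \<Rightarrow> ('v \<times> 'w) set \<Rightarrow> real" where
  "edge_vector_pair F G = (\<lambda>(l, m).
     \<lambda>e\<in>edges (F \<times>\<^sub>F G). if fst ` e \<in> edges F then l (fst ` e) else m (snd ` e))"

lemma edge_vector_pair_left:
  assumes "{u, v} \<in> edges F" "x \<in> verts G"
  shows "edge_vector_pair F G (l, m) {(u, x), (v, x)} = l {u, v}"
proof -
  have "{(u, x), (v, x)} \<in> edges (F \<times>\<^sub>F G)"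
    using assms unfolding framework_prod_def by auto
  then show ?thesis
    using assms by (simp add: edge_vector_pair_def)
qed

lemma edge_vector_pair_right:
  assumes "is_framework F" "u \<in> verts F" "{x, y} \<in> edges G"
  shows "edge_vector_pair F G (l, m) {(u, x), (u, y)} = m {x, y}"
proof -
  have "{(u, x), (u, y)} \<in> edges (F \<times>\<^sub>F G)"
    using assms unfolding framework_prod_def by auto
  moreover have "{u} \<notin> edges F"
    using assms(1) by (auto simp: is_framework_def)
  ultimately show ?thesis
    by (simp add: edge_vector_pair_def)
qed

end

theory Submission
  imports Defs
begin

text \<open>
  Along an edge \<open>{(u, x), (u, y)}\<close> a deformation of the product can only change the last \<open>e\<close>
  coordinates, so by connectivity of the second factor the first \<open>d\<close> coordinates of the image of
  \<open>(u, x)\<close> depend on \<open>u\<close> only. Symmetrically the last \<open>e\<close> coordinates depend on \<open>x\<close> only.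
  Hence the deformation is a product, and its coefficients are those of the factors.
\<close>

section \<open>Block arithmetic of concatenated vectors\<close>

lemma vec_append_nth [simp]:
  "vec_append a b $ Inl j = a $ j" "vec_append a b $ Inr k = b $ k"
  by (simp_all add: vec_append_def)

lemma vec_append_eq_iff: "h = vec_append a b \<longleftrightarrow> (\<forall>j. h $ Inl j = a $ j) \<and> (\<forall>k. h $ Inr k = b $ k)"
  by (auto simp: vec_eq_iff vec_append_def split: sum.split)

lemma vec_append_inject [simp]: "vec_append a b = vec_append a' b' \<longleftrightarrow> a = a' \<and> b = b'"
  by (metis vec_append_nth vec_eq_iff)

lemma vec_append_diff: "vec_append a b - vec_append a' b' = vec_append (a - a') (b - b')"
  by (simp add: vec_append_eq_iff)

lemma vec_append_scaleR: "l *\<^sub>R vec_append a b = vec_append (l *\<^sub>R a) (l *\<^sub>R b)"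
  by (simp add: vec_append_eq_iff)

section \<open>Vertices, positions and edges of a product framework\<close>

lemma verts_framework_prod [simp]: "verts (F \<times>\<^sub>F G) = verts F \<times> verts G"
  by (simp add: framework_prod_def)

lemma pos_framework_prod [simp]:
  "u \<in> verts F \<Longrightarrow> x \<in> verts G \<Longrightarrow> pos (F \<times>\<^sub>F G) (u, x) = vec_append (pos F u) (pos G x)"
  by (simp add: framework_prod_def)

text \<open>The comprehensions that define the edges name an unordered pair through chosen
  representatives. Matching doubletons in both orders turns this into a condition on the four given
  endpoints, usable for any orientation of an edge.\<close>

lemma edge_framework_prod_iff:
  "{(u, x), (v, y)} \<in> edges (F \<times>\<^sub>F G) \<longleftrightarrow>
     x = y \<and> x \<in> verts G \<and> {u, v} \<in> edges F \<or> u = v \<and> u \<in> verts F \<and> {x, y} \<in> edges G"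
  (is "?L \<longleftrightarrow> ?R")
proof
  show "?L \<Longrightarrow> ?R"
    by (auto simp: framework_prod_def doubleton_eq_iff insert_commute)
  show "?R \<Longrightarrow> ?L"
    unfolding framework_prod_def by auto
qed

lemma edge_framework_prodE:
  assumes "e \<in> edges (F \<times>\<^sub>F G)"
  obtains (left) u v x where "e = {(u, x), (v, x)}" "{u, v} \<in> edges F" "x \<in> verts G"
  | (right) u x y where "e = {(u, x), (u, y)}" "u \<in> verts F" "{x, y} \<in> edges G"
  using assms by (auto simp: framework_prod_def)

lemma edge_vertsD:
  assumes "is_framework F" "{u, v} \<in> edges F"
  shows "u \<in> verts F" "v \<in> verts F" "u \<noteq> v"
  using assms by (auto simp: is_framework_def)

lemma edge_is_doubleton:
  assumes "is_framework F" "e \<in> edges F"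
  obtains u v where "e = {u, v}"
  using assms by (auto simp: is_framework_def card_2_iff)

lemma is_framework_prod:
  assumes "is_framework F" "is_framework G"
  shows "is_framework (F \<times>\<^sub>F G)"
  unfolding is_framework_def
proof (intro conjI)
  show "finite (verts (F \<times>\<^sub>F G))"
    using assms by (simp add: is_framework_def)
  show "pos (F \<times>\<^sub>F G) \<in> extensional (verts (F \<times>\<^sub>F G))"
    by (simp add: framework_prod_def)
  have "e \<subseteq> verts (F \<times>\<^sub>F G) \<and> card e = 2" if "e \<in> edges (F \<times>\<^sub>F G)" for e
    using that
  proof (cases rule: edge_framework_prodE)
    case (left u v x)
    then show ?thesis
      using edge_vertsD[OF assms(1) left(2)] by simp
  next
    case (right u x y)
    then show ?thesis
      using edge_vertsD[OF assms(2) right(3)] by simp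
  qed
  then show "edges (F \<times>\<^sub>F G) \<subseteq> {e. e \<subseteq> verts (F \<times>\<^sub>F G) \<and> card e = 2}"
    by blast
qed

section \<open>Products of deformations are deformations\<close>

lemma is_deformationE:
  assumes "is_deformation F F'" "{u, v} \<in> edges F"
  obtains l where "l \<ge> 0" "pos F' v - pos F' u = l *\<^sub>R (pos F v - pos F u)"
  using assms unfolding is_deformation_def by blast

text \<open>The ends of a product edge differ in one factor only. The coefficient of the
  corresponding factor edge serves for the product edge as well, because the other block of both
  displacements is 0 and is preserved by every scaling.\<close>

lemma is_deformation_prod:
  assumes "is_framework F" "is_framework G" "is_deformation F F'" "is_deformation G G'"
  shows "is_deformation (F \<times>\<^sub>F G) (F' \<times>\<^sub>F G')"
proof -
  have F': "is_framework F'" "verts F' = verts F" "edges F' = edges F"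
    and G': "is_framework G'" "verts G' = verts G" "edges G' = edges G"
    using assms by (auto simp: is_deformation_def)
  have "\<exists>l\<ge>0. pos (F' \<times>\<^sub>F G') q - pos (F' \<times>\<^sub>F G') p
          = l *\<^sub>R (pos (F \<times>\<^sub>F G) q - pos (F \<times>\<^sub>F G) p)"
    if pq: "{p, q} \<in> edges (F \<times>\<^sub>F G)" for p q
  proof -
    obtain u x v y where [simp]: "p = (u, x)" "q = (v, y)"
      by (cases p, cases q)
    consider "x = y" "x \<in> verts G" "{u, v} \<in> edges F"
      | "u = v" "u \<in> verts F" "{x, y} \<in> edges G"
      using pq by (auto simp: edge_framework_prod_iff)
    then show ?thesis
    proof cases
      case 1
      then obtain l where "l \<ge> 0" "pos F' v - pos F' u = l *\<^sub>R (pos F v - pos F u)"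
        using is_deformationE[OF assms(3)] by blast
      then show ?thesis
        using 1 edge_vertsD[OF assms(1) 1(3)] F' G'
        by (auto simp: vec_append_diff vec_append_scaleR)
    next
      case 2
      then obtain l where "l \<ge> 0" "pos G' y - pos G' x = l *\<^sub>R (pos G y - pos G x)"
        using is_deformationE[OF assms(4)] by blast
      then show ?thesis
        using 2 edge_vertsD[OF assms(2) 2(3)] F' G'
        by (auto simp: vec_append_diff vec_append_scaleR)
    qed
  qed
  moreover have "verts (F' \<times>\<^sub>F G') = verts (F \<times>\<^sub>F G)" "edges (F' \<times>\<^sub>F G') = edges (F \<times>\<^sub>F G)"
    using F' G' by (simp_all add: framework_prod_def)
  ultimately show ?thesis
    unfolding is_deformation_def using is_framework_prod[OF F'(1) G'(1)] by blast
qed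

section \<open>Splitting a deformation of the product\<close>

text \<open>Equality propagates along a path by induction on its length. The function
  \<open>f\<close> will be a single coordinate of a deformation, restricted to one copy of a factor
  inside the product.\<close>

lemma connected_framework_eq:
  assumes "connected_framework F" "u \<in> verts F" "v \<in> verts F"
    and eq: "\<And>a b. {a, b} \<in> edges F \<Longrightarrow> f a = f b"
  shows "f u = f v"
proof -
  have "(u, v) \<in> {(a, b). {a, b} \<in> edges F}\<^sup>*"
    using assms(1-3) by (simp add: connected_framework_def)
  then show ?thesis
    by (induction rule: rtrancl_induct) (auto dest: eq)
qed

lemma deformation_of_prodE:
  fixes F :: "('v, 'd :: finite) framework" and G :: "('w, 'e :: finite) framework"
  assumes F: "is_framework F" "connected_framework F"
    and G: "is_framework G" "connected_framework G"
    and H: "is_deformation (F \<times>\<^sub>F G) H"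
  obtains F' :: "('v, 'd) framework" and G' :: "('w, 'e) framework"
  where "is_deformation F F'" "is_deformation G G'" "H = F' \<times>\<^sub>F G'"
proof -
  obtain u0 x0 where u0: "u0 \<in> verts F" and x0: "x0 \<in> verts G"
    using F(2) G(2) unfolding connected_framework_def by blast
  \<comment> \<open>The factors are read off from the two slices through \<open>(u0, x0)\<close>:
    the first block on the copy of \<open>F\<close> at \<open>x0\<close>, the second block on the
    copy of \<open>G\<close> at \<open>u0\<close>. Restricting the maps to the vertex sets makes
    them extensional, as \<open>is_framework\<close> demands.\<close>
  define F' where
    "F' = \<lparr>verts = verts F, edges = edges F, pos = (\<lambda>u\<in>verts F. \<chi> j. pos H (u, x0) $ Inl j)\<rparr>"
  define G' where
    "G' = \<lparr>verts = verts G, edges = edges G, pos = (\<lambda>x\<in>verts G. \<chi> k. pos H (u0, x) $ Inr k)\<rparr>"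
  \<comment> \<open>The original positions of the two ends share their second block, so the
    displacement in \<open>H\<close> vanishes there whatever the coefficient is.\<close>
  have left: "\<exists>l\<ge>0. pos H (v, x) - pos H (u, x) = vec_append (l *\<^sub>R (pos F v - pos F u)) 0"
    if "{u, v} \<in> edges F" "x \<in> verts G" for u v x
  proof -
    have "{(u, x), (v, x)} \<in> edges (F \<times>\<^sub>F G)"
      using that by (simp add: edge_framework_prod_iff)
    from is_deformationE[OF H this] obtain l where "l \<ge> 0" and
      "pos H (v, x) - pos H (u, x) = l *\<^sub>R (pos (F \<times>\<^sub>F G) (v, x) - pos (F \<times>\<^sub>F G) (u, x))" .
    then show ?thesis
      using that edge_vertsD[OF F(1) that(1)]
      by (intro exI[of _ l]) (simp add: vec_append_diff vec_append_scaleR)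
  qed
  have right: "\<exists>l\<ge>0. pos H (u, y) - pos H (u, x) = vec_append 0 (l *\<^sub>R (pos G y - pos G x))"
    if "{x, y} \<in> edges G" "u \<in> verts F" for u x y
  proof -
    have "{(u, x), (u, y)} \<in> edges (F \<times>\<^sub>F G)"
      using that by (simp add: edge_framework_prod_iff)
    from is_deformationE[OF H this] obtain l where "l \<ge> 0" and
      "pos H (u, y) - pos H (u, x) = l *\<^sub>R (pos (F \<times>\<^sub>F G) (u, y) - pos (F \<times>\<^sub>F G) (u, x))" .
    then show ?thesis
      using that edge_vertsD[OF G(1) that(1)]
      by (intro exI[of _ l]) (simp add: vec_append_diff vec_append_scaleR)
  qed
  \<comment> \<open>This and \<open>Inr_eq\<close> below show that the choice of the slices does not
    matter: every parallel copy of a factor has the same relevant block.\<close>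
  have Inl_eq: "pos H (u, x) $ Inl j = pos H (u, x0) $ Inl j" if "u \<in> verts F" "x \<in> verts G" for u x j
  proof (rule connected_framework_eq[OF G(2) that(2) x0])
    fix a b assume "{a, b} \<in> edges G"
    from right[OF this that(1)] have "(pos H (u, b) - pos H (u, a)) $ Inl j = 0"
      by (metis vec_append_nth(1) zero_index)
    then show "pos H (u, a) $ Inl j = pos H (u, b) $ Inl j"
      by simp
  qed
  have Inr_eq: "pos H (u, x) $ Inr k = pos H (u0, x) $ Inr k" if "u \<in> verts F" "x \<in> verts G" for u x k
  proof (rule connected_framework_eq[OF F(2) that(1) u0])
    fix a b assume "{a, b} \<in> edges F"
    from left[OF this that(2)] have "(pos H (b, x) - pos H (a, x)) $ Inr k = 0"
      by (metis vec_append_nth(2) zero_index)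
    then show "pos H (a, x) $ Inr k = pos H (b, x) $ Inr k"
      by simp
  qed
  have "\<exists>l\<ge>0. pos F' v - pos F' u = l *\<^sub>R (pos F v - pos F u)" if e: "{u, v} \<in> edges F" for u v
  proof -
    obtain l where "l \<ge> 0" "pos H (v, x0) - pos H (u, x0) = vec_append (l *\<^sub>R (pos F v - pos F u)) 0"
      using left[OF e x0] by blast
    then show ?thesis
      using edge_vertsD[OF F(1) e]
      by (intro exI[of _ l]) (simp add: F'_def vec_append_eq_iff vec_eq_iff)
  qed
  moreover have "is_framework F'" "verts F' = verts F" "edges F' = edges F"
    using F(1) by (simp_all add: is_framework_def F'_def)
  ultimately have F': "is_deformation F F'"
    unfolding is_deformation_def by blast
  have "\<exists>l\<ge>0. pos G' y - pos G' x = l *\<^sub>R (pos G y - pos G x)" if e: "{x, y} \<in> edges G" for x y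
  proof -
    obtain l where "l \<ge> 0" "pos H (u0, y) - pos H (u0, x) = vec_append 0 (l *\<^sub>R (pos G y - pos G x))"
      using right[OF e u0] by blast
    then show ?thesis
      using edge_vertsD[OF G(1) e]
      by (intro exI[of _ l]) (simp add: G'_def vec_append_eq_iff vec_eq_iff)
  qed
  moreover have "is_framework G'" "verts G' = verts G" "edges G' = edges G"
    using G(1) by (simp_all add: is_framework_def G'_def)
  ultimately have G': "is_deformation G G'"
    unfolding is_deformation_def by blast
  have "H = F' \<times>\<^sub>F G'"
  \<comment> \<open>Equality of records is checked field by field; the trivial extension field
    \<open>more\<close> is left to the closing \<open>simp\<close>. The positions agree off the
    vertex set because both maps are extensional, and on it by the two slice equations.\<close>
  proof (rule framework.equality)
    have V: "verts H = verts F \<times> verts G" and E: "edges H = edges (F \<times>\<^sub>F G)"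
      and ext: "pos H \<in> extensional (verts F \<times> verts G)"
      using H unfolding is_deformation_def is_framework_def by (metis verts_framework_prod)+
    show "verts H = verts (F' \<times>\<^sub>F G')"
      using V by (simp add: F'_def G'_def)
    show "edges H = edges (F' \<times>\<^sub>F G')"
      using E by (simp add: framework_prod_def F'_def G'_def)
    show "pos H = pos (F' \<times>\<^sub>F G')"
    proof (rule extensionalityI[OF ext])
      show "pos (F' \<times>\<^sub>F G') \<in> extensional (verts F \<times> verts G)"
        by (simp add: framework_prod_def F'_def G'_def)
    next
      fix p assume "p \<in> verts F \<times> verts G"
      then obtain u x where p: "p = (u, x)" "u \<in> verts F" "x \<in> verts G"
        by blast
      then show "pos H p = pos (F' \<times>\<^sub>F G') p"
        using Inl_eq[OF p(2,3)] Inr_eq[OF p(2,3)]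
        by (simp add: framework_prod_def F'_def G'_def vec_append_eq_iff)
    qed
  qed simp
  then show thesis
    by (rule that[OF F' G'])
qed

section \<open>Edge-deformation vectors of products\<close>

lemma degenerate_doubleton [simp]: "degenerate F {u, v} \<longleftrightarrow> pos F u = pos F v"
  unfolding degenerate_def by (metis doubleton_eq_iff)

lemma edge_deformation_vector_degenerate:
  "{u, v} \<in> edges F \<Longrightarrow> pos F u = pos F v \<Longrightarrow> edge_deformation_vector F F' {u, v} = 0"
  by (simp add: edge_deformation_vector_def)

text \<open>The displacement of a non-degenerate edge is a nonzero vector, so its multiple
  determines the scalar. This makes the definite description computable from one orientation of the
  edge.\<close>

lemma edge_deformation_vector_eqI:
  assumes "{u, v} \<in> edges F" "pos F u \<noteq> pos F v" "l \<ge> 0"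
    and l: "pos F' v - pos F' u = l *\<^sub>R (pos F v - pos F u)"
  shows "edge_deformation_vector F F' {u, v} = l"
proof -
  have "(THE l. l \<ge> 0 \<and> (\<forall>a b. {u, v} = {a, b} \<longrightarrow>
           pos F' b - pos F' a = l *\<^sub>R (pos F b - pos F a))) = l"
  proof (rule the_equality)
    \<comment> \<open>The description quantifies over both orientations; reversing the edge negates
      both sides and keeps the coefficient.\<close>
    have "pos F' u - pos F' v = l *\<^sub>R (pos F u - pos F v)"
      using l by (metis minus_diff_eq scaleR_minus_right)
    then show "l \<ge> 0 \<and> (\<forall>a b. {u, v} = {a, b} \<longrightarrow>
           pos F' b - pos F' a = l *\<^sub>R (pos F b - pos F a))"
      using l \<open>l \<ge> 0\<close> by (auto simp: doubleton_eq_iff)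
  next
    fix l' assume "l' \<ge> 0 \<and> (\<forall>a b. {u, v} = {a, b} \<longrightarrow>
           pos F' b - pos F' a = l' *\<^sub>R (pos F b - pos F a))"
    then have "l' *\<^sub>R (pos F v - pos F u) = l *\<^sub>R (pos F v - pos F u)"
      using l by metis
    then show "l' = l"
      using assms(2) by simp
  qed
  then show ?thesis
    using assms by (simp add: edge_deformation_vector_def)
qed

text \<open>The positions of \<open>x\<close> cancel in the differences. Hence the product edge is
  degenerate exactly when \<open>{u, v}\<close> is, where both values are 0; otherwise one
  \<open>l\<close> satisfies the defining equations of both coefficients.\<close>

lemma edge_deformation_vector_prod_left:
  assumes "is_framework F" "is_deformation F F'" "verts G' = verts G"
    and e: "{u, v} \<in> edges F" and x: "x \<in> verts G"
  shows "edge_deformation_vector (F \<times>\<^sub>F G) (F' \<times>\<^sub>F G') {(u, x), (v, x)}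
    = edge_deformation_vector F F' {u, v}"
proof -
  have V: "verts F' = verts F"
    using assms by (simp add: is_deformation_def)
  note uv = edge_vertsD[OF assms(1) e]
  have E: "{(u, x), (v, x)} \<in> edges (F \<times>\<^sub>F G)"
    using e x by (simp add: edge_framework_prod_iff)
  show ?thesis
  proof (cases "pos F u = pos F v")
    case True
    then show ?thesis
      using E e uv x by (simp add: edge_deformation_vector_degenerate)
  next
    case False
    obtain l where l: "l \<ge> 0" "pos F' v - pos F' u = l *\<^sub>R (pos F v - pos F u)"
      using is_deformationE[OF assms(2) e] .
    have "edge_deformation_vector (F \<times>\<^sub>F G) (F' \<times>\<^sub>F G') {(u, x), (v, x)} = l"
      using E False l uv x V assms(3)
      by (intro edge_deformation_vector_eqI) (auto simp: vec_append_diff vec_append_scaleR)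
    then show ?thesis
      using edge_deformation_vector_eqI[where F' = F', OF e False l] by simp
  qed
qed

lemma edge_deformation_vector_prod_right:
  assumes "is_framework G" "is_deformation G G'" "verts F' = verts F"
    and e: "{x, y} \<in> edges G" and u: "u \<in> verts F"
  shows "edge_deformation_vector (F \<times>\<^sub>F G) (F' \<times>\<^sub>F G') {(u, x), (u, y)}
    = edge_deformation_vector G G' {x, y}"
proof -
  have V: "verts G' = verts G"
    using assms by (simp add: is_deformation_def)
  note xy = edge_vertsD[OF assms(1) e]
  have E: "{(u, x), (u, y)} \<in> edges (F \<times>\<^sub>F G)"
    using e u by (simp add: edge_framework_prod_iff)
  show ?thesis
  proof (cases "pos G x = pos G y")
    case True
    then show ?thesis
      using E e xy u by (simp add: edge_deformation_vector_degenerate)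
  next
    case False
    obtain l where l: "l \<ge> 0" "pos G' y - pos G' x = l *\<^sub>R (pos G y - pos G x)"
      using is_deformationE[OF assms(2) e] .
    have "edge_deformation_vector (F \<times>\<^sub>F G) (F' \<times>\<^sub>F G') {(u, x), (u, y)} = l"
      using E False l xy u V assms(3)
      by (intro edge_deformation_vector_eqI) (auto simp: vec_append_diff vec_append_scaleR)
    then show ?thesis
      using edge_deformation_vector_eqI[where F' = G', OF e False l] by simp
  qed
qed

text \<open>This transfers statements about deformations to statements about cones. Both sides are
  extensional on the edges of the product, so comparing them on the two kinds of edges
  suffices.\<close>

lemma edge_deformation_vector_prod:
  assumes F: "is_framework F" and G: "is_framework G"
    and F': "is_deformation F F'" and G': "is_deformation G G'"
  shows "edge_deformation_vector (F \<times>\<^sub>F G) (F' \<times>\<^sub>F G')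
    = edge_vector_pair F G (edge_deformation_vector F F', edge_deformation_vector G G')"
proof (rule extensionalityI)
  show "edge_deformation_vector (F \<times>\<^sub>F G) (F' \<times>\<^sub>F G') \<in> extensional (edges (F \<times>\<^sub>F G))"
    by (simp add: edge_deformation_vector_def)
  show "edge_vector_pair F G (edge_deformation_vector F F', edge_deformation_vector G G')
      \<in> extensional (edges (F \<times>\<^sub>F G))"
    by (simp add: edge_vector_pair_def)
next
  have V: "verts F' = verts F" "verts G' = verts G"
    using F' G' by (simp_all add: is_deformation_def)
  fix e assume "e \<in> edges (F \<times>\<^sub>F G)"
  then show "edge_deformation_vector (F \<times>\<^sub>F G) (F' \<times>\<^sub>F G') e
    = edge_vector_pair F G (edge_deformation_vector F F', edge_deformation_vector G G') e"
  proof (cases rule: edge_framework_prodE)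
    case (left u v x)
    then show ?thesis
      by (simp add: edge_deformation_vector_prod_left[OF F F' V(2)] edge_vector_pair_left)
  next
    case (right u x y)
    then show ?thesis
      by (simp add: edge_deformation_vector_prod_right[OF G G' V(1)] edge_vector_pair_right[OF F])
  qed
qed

section \<open>Injectivity of the identification of pairs, and the cone identity\<close>

lemma deformation_cone_extensional: "deformation_cone F \<subseteq> extensional (edges F)"
  by (auto simp: deformation_cone_def edge_deformation_vector_def)

text \<open>Each coordinate of \<open>l\<close> reappears on the copy of its edge at
  \<open>x0\<close>, and each coordinate of \<open>m\<close> on the copy at \<open>u0\<close>. The
  factors must have vertices: without a vertex in \<open>G\<close> the product has no edges and
  \<open>l\<close> is lost. Extensionality fixes the values off the edge sets, which the pairing
  does not see.\<close>

lemma inj_on_edge_vector_pair: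
  assumes F: "is_framework F" "verts F \<noteq> {}" and G: "is_framework G" "verts G \<noteq> {}"
  shows "inj_on (edge_vector_pair F G) (extensional (edges F) \<times> extensional (edges G))"
proof (rule inj_onI, clarify)
  fix l m l' m'
  assume l: "l \<in> extensional (edges F)" "l' \<in> extensional (edges F)"
    and m: "m \<in> extensional (edges G)" "m' \<in> extensional (edges G)"
    and eq: "edge_vector_pair F G (l, m) = edge_vector_pair F G (l', m')"
  obtain u0 x0 where u0: "u0 \<in> verts F" and x0: "x0 \<in> verts G"
    using F G by blast
  have "l = l'"
  proof (rule extensionalityI[OF l])
    fix e assume e: "e \<in> edges F"
    then obtain u v where "e = {u, v}"
      using edge_is_doubleton[OF F(1)] by blast
    then show "l e = l' e"
      using e x0 eq by (metis edge_vector_pair_left)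
  qed
  moreover have "m = m'"
  proof (rule extensionalityI[OF m])
    fix e assume e: "e \<in> edges G"
    then obtain x y where "e = {x, y}"
      using edge_is_doubleton[OF G(1)] by blast
    then show "m e = m' e"
      using e u0 eq by (metis edge_vector_pair_right[OF F(1)])
  qed
  ultimately show "l = l' \<and> m = m'"
    by simp
qed

theorem theorem2p4p17:
  fixes F :: "('v, 'd :: finite) framework" and G :: "('w, 'e :: finite) framework"
  assumes "is_framework F" and "is_framework G"
    and "connected_framework F" and "connected_framework G"
  shows "(\<forall>H. is_deformation (F \<times>\<^sub>F G) H \<longrightarrow>
            (\<exists>F' G'. is_deformation F F' \<and> is_deformation G G' \<and> H = F' \<times>\<^sub>F G'))
       \<and> inj_on (edge_vector_pair F G) (deformation_cone F \<times> deformation_cone G)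
       \<and> deformation_cone (F \<times>\<^sub>F G) =
           edge_vector_pair F G ` (deformation_cone F \<times> deformation_cone G)"
proof (intro conjI)
  show "\<forall>H. is_deformation (F \<times>\<^sub>F G) H \<longrightarrow>
      (\<exists>F' G'. is_deformation F F' \<and> is_deformation G G' \<and> H = F' \<times>\<^sub>F G')"
    using deformation_of_prodE[OF assms(1,3,2,4)] by metis
  show "inj_on (edge_vector_pair F G) (deformation_cone F \<times> deformation_cone G)"
    \<comment> \<open>Connectedness supplies the vertices, and both cones consist of extensional
      vectors, so injectivity restricts to them.\<close>
    using assms by (intro inj_on_subset[OF inj_on_edge_vector_pair] Sigma_mono
        deformation_cone_extensional) (auto simp: connected_framework_def)
  show "deformation_cone (F \<times>\<^sub>F G) =
      edge_vector_pair F G ` (deformation_cone F \<times> deformation_cone G)"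
  proof (intro equalityI subsetI)
    \<comment> \<open>This inclusion rests on the splitting of \<open>H\<close>; the converse only
      needs that products of deformations are deformations, together with the formula for their
      vectors.\<close>
    fix k assume "k \<in> deformation_cone (F \<times>\<^sub>F G)"
    then obtain H where H: "is_deformation (F \<times>\<^sub>F G) H"
      and k: "k = edge_deformation_vector (F \<times>\<^sub>F G) H"
      by (auto simp: deformation_cone_def)
    obtain F' G' where "is_deformation F F'" "is_deformation G G'" "H = F' \<times>\<^sub>F G'"
      using deformation_of_prodE[OF assms(1,3,2,4) H] .
    then show "k \<in> edge_vector_pair F G ` (deformation_cone F \<times> deformation_cone G)"
      unfolding k deformation_cone_def
      using edge_deformation_vector_prod[OF assms(1,2)] by blast
  next
    fix k assume "k \<in> edge_vector_pair F G ` (deformation_cone F \<times> deformation_cone G)"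
    then obtain F' G' where "is_deformation F F'" "is_deformation G G'"
      and "k = edge_vector_pair F G (edge_deformation_vector F F', edge_deformation_vector G G')"
      by (auto simp: deformation_cone_def)
    then show "k \<in> deformation_cone (F \<times>\<^sub>F G)"
      unfolding deformation_cone_def
      using edge_deformation_vector_prod[OF assms(1,2)] is_deformation_prod[OF assms(1,2)]
      by (metis (mono_tags, lifting) mem_Collect_eq)
  qed
qed

end
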